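(* Let $G=(V,E)$ be a finite simple undirected graph, let $h$ be a positive integer, and let $H^{(n)}\mathrm{sup}(e)$ ($n\ge 0$, $e\in E$) be the higher-order H-index sequence defined below. Then for every positive integer $n$ and every edge $e\in E$, $H^{(n)}\mathrm{sup}(e)\ge H^{(n+1)}\mathrm{sup}(e)$.
   Context: $\mathrm{dist}_G$ is shortest-path distance in $G$. For a vertex $x$, $N_G(x,h)=\{y\neq x:\mathrm{dist}_G(x,y)\le h\}$. For an edge $e=(u,v)\in E$, the set of common $h$-neighbors is $\triangle_G(e,h)=N_G(u,h)\cap N_G(v,h)$ and the $h$-support is $\sup_G(e,h)=|\triangle_G(e,h)|$. For a finite multiset $M$ of nonnegative integers, $\mathcal{H}(M)$ is the largest integer $y\ge 0$ such that at least $y$ elements of $M$ are $\ge y$. Define $H^{(0)}\mathrm{sup}(e)=\sup_G(e,h)$ for all $e\in E$. For $n\ge 1$ and vertices $a,b$, let $P^{(n)}(a,b)=\max_{p}\min\{H^{(n-1)}\mathrm{sup}(f): f\text{ an edge of }p\}$, the maximum taken over all paths $p$ in $G$ from $a$ to $b$ with at most $h$ edges; and for $e=(u,v)\in E$ let $H^{(n)}\mathrm{sup}(e)=\mathcal{H}\big(\{\min(P^{(n)}(u,w),P^{(n)}(v,w)) : w\in\triangle_G(e,h)\}\big)$ (a multiset indexed by $w$). *)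

theory Defs
  imports Main "HOL-Library.Multiset" "HOL-Library.Extended_Nat"
begin

text \<open>Edges are two-element vertex sets, so graphs are undirected, without loops or multiple edges.\<close>

definition finite_simple_graph :: "'a set \<Rightarrow> 'a set set \<Rightarrow> bool" where
  "finite_simple_graph V E \<longleftrightarrow> finite V \<and> (\<forall>e\<in>E. e \<subseteq> V \<and> card e = 2)"

text \<open>A path is its list of vertices; it has one edge fewer than vertices.\<close>

definition path_edges :: "'a list \<Rightarrow> 'a set set" where
  "path_edges p = {{p ! i, p ! Suc i} |i. Suc i < length p}"

definition path_length :: "'a list \<Rightarrow> nat" where
  "path_length p = length p - 1"

definition is_path :: "'a set \<Rightarrow> 'a set set \<Rightarrow> 'a \<Rightarrow> 'a list \<Rightarrow> 'a \<Rightarrow> bool" where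
  "is_path V E a p b \<longleftrightarrow>
     p \<noteq> [] \<and> hd p = a \<and> last p = b \<and> distinct p \<and> set p \<subseteq> V \<and> path_edges p \<subseteq> E"

text \<open>The distance of vertices in different components is \<open>\<infinity>\<close>, the infimum of the empty set.\<close>

definition graph_dist :: "'a set \<Rightarrow> 'a set set \<Rightarrow> 'a \<Rightarrow> 'a \<Rightarrow> enat" where
  "graph_dist V E a b = (INF p\<in>{p. is_path V E a p b}. enat (path_length p))"

definition nbhd :: "'a set \<Rightarrow> 'a set set \<Rightarrow> 'a \<Rightarrow> nat \<Rightarrow> 'a set" where
  "nbhd V E x h = {y \<in> V. y \<noteq> x \<and> graph_dist V E x y \<le> enat h}"

text \<open>For \<open>e = {u, v}\<close> this is the intersection of the neighborhoods of \<open>u\<close> and \<open>v\<close>.\<close>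

definition common_nbrs :: "'a set \<Rightarrow> 'a set set \<Rightarrow> 'a set \<Rightarrow> nat \<Rightarrow> 'a set" where
  "common_nbrs V E e h = (\<Inter>u\<in>e. nbhd V E u h)"

definition support :: "'a set \<Rightarrow> 'a set set \<Rightarrow> 'a set \<Rightarrow> nat \<Rightarrow> nat" where
  "support V E e h = card (common_nbrs V E e h)"

definition H_index :: "nat multiset \<Rightarrow> nat" where
  "H_index M = Max {y. y \<le> size (filter_mset (\<lambda>m. y \<le> m) M)}"

text \<open>
  The value for an edge weighting \<open>f\<close> is meaningful when \<open>a \<noteq> b\<close> and \<open>b\<close> is within distance \<open>h\<close>
  of \<open>a\<close>: then there is an admissible path and every such path has an edge. It is only
  used in this situation.
\<close>

definition max_min_path :: "'a set \<Rightarrow> 'a set set \<Rightarrow> nat \<Rightarrow> ('a set \<Rightarrow> nat) \<Rightarrow> 'a \<Rightarrow> 'a \<Rightarrow> nat" where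
  "max_min_path V E h f a b =
     Max {Min (f ` path_edges p) |p. is_path V E a p b \<and> path_length p \<le> h}"

text \<open>
  For \<open>e = {u, v}\<close> the inner minimum is taken over the two endpoints \<open>u\<close> and \<open>v\<close>;
  see \<open>H_sup_Suc_edge\<close>.
\<close>

primrec H_sup :: "'a set \<Rightarrow> 'a set set \<Rightarrow> nat \<Rightarrow> nat \<Rightarrow> 'a set \<Rightarrow> nat" where
  "H_sup V E h 0 = (\<lambda>e. support V E e h)"
| "H_sup V E h (Suc n) = (\<lambda>e. H_index
     {# Min ((\<lambda>u. max_min_path V E h (H_sup V E h n) u w) ` e).
        w \<in># mset_set (common_nbrs V E e h) #})"

lemma common_nbrs_edge: "common_nbrs V E {u, v} h = nbhd V E u h \<inter> nbhd V E v h"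
  by (simp add: common_nbrs_def)

lemma H_sup_Suc_edge:
  "H_sup V E h (Suc n) {u, v} = H_index
     {# min (max_min_path V E h (H_sup V E h n) u w) (max_min_path V E h (H_sup V E h n) v w).
        w \<in># mset_set (nbhd V E u h \<inter> nbhd V E v h) #}"
  by (simp add: common_nbrs_edge)

end

(* The step from one term of the sequence to the next is monotone in the edge weights, and the
   first step does not increase them, because the H-index of a multiset is at most its size. Hence
   the whole sequence is decreasing by induction. *)
theory Submission
  imports Defs
begin

text \<open>No candidate exceeds the size of \<open>M\<close>, so the \<open>Max\<close> in
  \<open>H_index\<close> ranges over a finite set.\<close>

lemma finite_H_index_set: "finite {y. y \<le> size (filter_mset (\<lambda>m. y \<le> m) M)}"
proof (rule finite_subset)
  show "{y. y \<le> size (filter_mset (\<lambda>m. y \<le> m) M)} \<subseteq> {..size M}"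
    using size_filter_mset_lesseq order_trans by fastforce
qed simp

lemma H_index_greatest:
  assumes "y \<le> size (filter_mset (\<lambda>m. y \<le> m) M)"
  shows "y \<le> H_index M"
  unfolding H_index_def using assms by (intro Max_ge finite_H_index_set) simp

lemma H_index_le_size_filter: "H_index M \<le> size (filter_mset (\<lambda>m. H_index M \<le> m) M)"
proof -
  have "H_index M \<in> {y. y \<le> size (filter_mset (\<lambda>m. y \<le> m) M)}"
    unfolding H_index_def
    by (rule Max_in[OF finite_H_index_set]) (use le0 in blast)
  then show ?thesis by simp
qed

lemma H_index_le_size: "H_index M \<le> size M"
  using H_index_le_size_filter size_filter_mset_lesseq order_trans by blast

lemma size_filter_mset_mono:
  assumes "\<And>x. x \<in># M \<Longrightarrow> P x \<Longrightarrow> Q x"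
  shows "size (filter_mset P M) \<le> size (filter_mset Q M)"
  using assms by (induction M) (auto intro: le_SucI)

text \<open>If y is the H-index of the smaller family, then at least y indices x satisfy y \<le>
  \<open>f x\<close> \<le> \<open>g x\<close>, so y is also a candidate for the larger
  family.\<close>

lemma H_index_image_mono:
  assumes "\<And>x. x \<in># M \<Longrightarrow> f x \<le> g x"
  shows "H_index (image_mset f M) \<le> H_index (image_mset g M)"
proof (rule H_index_greatest)
  let ?y = "H_index (image_mset f M)"
  have "?y \<le> size (filter_mset (\<lambda>x. ?y \<le> f x) M)"
    using H_index_le_size_filter[of "image_mset f M"] by (simp add: filter_mset_image_mset)
  also have "\<dots> \<le> size (filter_mset (\<lambda>x. ?y \<le> g x) M)"
    using assms by (intro size_filter_mset_mono) (auto intro: order_trans)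
  finally show "?y \<le> size (filter_mset (\<lambda>m. ?y \<le> m) (image_mset g M))"
    by (simp add: filter_mset_image_mset)
qed

lemma Min_image_mono:
  fixes f g :: "'b \<Rightarrow> 'c::linorder"
  assumes "finite A" "A \<noteq> {}" "\<And>x. x \<in> A \<Longrightarrow> f x \<le> g x"
  shows "Min (f ` A) \<le> Min (g ` A)"
proof (rule Min.boundedI)
  fix y assume "y \<in> g ` A"
  then obtain x where x: "x \<in> A" "y = g x" by blast
  then have "Min (f ` A) \<le> f x" using assms(1) by simp
  also have "\<dots> \<le> y" using x assms(3) by simp
  finally show "Min (f ` A) \<le> y" .
qed (use assms in auto)

lemma Max_image_mono:
  fixes f g :: "'b \<Rightarrow> 'c::linorder"
  assumes "finite A" "A \<noteq> {}" "\<And>x. x \<in> A \<Longrightarrow> f x \<le> g x"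
  shows "Max (f ` A) \<le> Max (g ` A)"
proof (rule Max.boundedI)
  fix y assume "y \<in> f ` A"
  then obtain x where x: "x \<in> A" "y = f x" by blast
  then have "y \<le> g x" using assms(3) by simp
  also have "\<dots> \<le> Max (g ` A)" using x assms(1) by simp
  finally show "y \<le> Max (g ` A)" .
qed (use assms in auto)

lemma finite_path_edges: "finite (path_edges p)"
proof -
  have "path_edges p = (\<lambda>i. {p ! i, p ! Suc i}) ` {i. Suc i < length p}"
    by (auto simp: path_edges_def)
  moreover have "finite {i. Suc i < length p}"
    by (rule finite_subset[of _ "{..<length p}"]) auto
  ultimately show ?thesis by simp
qed

text \<open>Keeps the \<open>Min\<close> over the edges of a path away from the empty set, where its
  value is unspecified.\<close>

lemma path_edges_nonempty:
  assumes "is_path V E a p b" "a \<noteq> b"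
  shows "path_edges p \<noteq> {}"
proof -
  have "Suc 0 < length p"
    \<comment> \<open>The case rule separates lists with no, one and at least two vertices; a single
      vertex would force \<open>a = b\<close>.\<close>
    using assms by (cases p rule: remdups_adj.cases) (auto simp: is_path_def)
  then show ?thesis by (auto simp: path_edges_def)
qed

text \<open>Paths repeat no vertex, and a finite set carries only finitely many lists of distinct
  elements.\<close>

lemma finite_paths:
  assumes "finite V"
  shows "finite {p. is_path V E a p b \<and> path_length p \<le> h}"
  by (rule finite_subset[OF _ finite_subset_distinct[OF assms]]) (auto simp: is_path_def)

text \<open>If every path were longer than \<open>h\<close>, then \<open>Suc h\<close> would be a
  lower bound for all path lengths, hence for the distance. This includes the case without any path,
  where the infimum is \<infinity>.\<close>

lemma short_path_exists:
  assumes "graph_dist V E a b \<le> enat h"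
  shows "\<exists>p. is_path V E a p b \<and> path_length p \<le> h"
proof (rule ccontr)
  assume "\<not> ?thesis"
  then have "enat (Suc h) \<le> graph_dist V E a b"
    unfolding graph_dist_def by (intro INF_greatest) (auto simp: not_le Suc_le_eq)
  with assms have "enat (Suc h) \<le> enat h" by (rule order_trans[rotated])
  then show False by simp
qed

text \<open>Membership of \<open>w\<close> in the neighborhood serves twice: it yields a path of
  length at most \<open>h\<close>, so the \<open>Max\<close> is over a nonempty set, and it gives
  \<open>w \<noteq> a\<close>, so each path has an edge. Since paths use edges of \<open>E\<close>
  only, comparing the weights on \<open>E\<close> suffices.\<close>

lemma max_min_path_mono:
  assumes "finite V" "w \<in> nbhd V E a h" "\<And>e. e \<in> E \<Longrightarrow> f e \<le> g e"
  shows "max_min_path V E h f a w \<le> max_min_path V E h g a w"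
proof -
  let ?P = "{p. is_path V E a p w \<and> path_length p \<le> h}"
  have "Max ((\<lambda>p. Min (f ` path_edges p)) ` ?P) \<le> Max ((\<lambda>p. Min (g ` path_edges p)) ` ?P)"
  proof (rule Max_image_mono)
    show "finite ?P" by (rule finite_paths[OF assms(1)])
    show "?P \<noteq> {}"
      using assms(2) short_path_exists[of V E a w h] by (auto simp: nbhd_def)
    fix p assume "p \<in> ?P"
    then have p: "is_path V E a p w" by simp
    then show "Min (f ` path_edges p) \<le> Min (g ` path_edges p)"
      using assms(2,3)
      by (intro Min_image_mono finite_path_edges path_edges_nonempty[OF p])
        (auto simp: nbhd_def is_path_def)
  qed
  then show ?thesis by (simp add: max_min_path_def setcompr_eq_image)
qed

lemma H_sup_Suc_le:
  assumes G: "finite_simple_graph V E" and "e \<in> E"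
  shows "H_sup V E h (Suc n) e \<le> H_sup V E h n e"
  using \<open>e \<in> E\<close>
\<comment> \<open>The value at \<open>e\<close> depends on the previous weights of all edges on the
  paths involved, so the induction hypothesis must cover every edge.\<close>
proof (induction n arbitrary: e)
  case 0
  have "H_sup V E h (Suc 0) e \<le> size (mset_set (common_nbrs V E e h))"
    unfolding H_sup.simps(2) using H_index_le_size by (metis size_image_mset)
  \<comment> \<open>The multiset has one entry per common neighbor, so its size is the
    support.\<close>
  then show ?case by (simp add: support_def del: H_sup.simps(2))
next
  case (Suc n)
  have "finite V" and "card e = 2"
    using G Suc.prems by (auto simp: finite_simple_graph_def)
  then have "finite e" "e \<noteq> {}"
    by (auto intro: card_ge_0_finite)
  \<comment> \<open>An endpoint in \<open>e\<close> is needed here, as an empty intersection would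
    be the whole type. Finiteness then makes the elements of the \<open>mset_set\<close> exactly the
    common neighbors.\<close>
  then have "finite (common_nbrs V E e h)"
    using \<open>finite V\<close> unfolding common_nbrs_def nbhd_def by (intro finite_INT) auto
  have le: "max_min_path V E h (H_sup V E h (Suc n)) u w \<le> max_min_path V E h (H_sup V E h n) u w"
    if "u \<in> e" "w \<in> common_nbrs V E e h" for u w
    using that by (intro max_min_path_mono \<open>finite V\<close> Suc.IH) (simp_all add: common_nbrs_def)
  have "H_index (image_mset (\<lambda>w. Min ((\<lambda>u. max_min_path V E h (H_sup V E h (Suc n)) u w) ` e))
            (mset_set (common_nbrs V E e h)))
      \<le> H_index (image_mset (\<lambda>w. Min ((\<lambda>u. max_min_path V E h (H_sup V E h n) u w) ` e))
            (mset_set (common_nbrs V E e h)))"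
    using \<open>finite (common_nbrs V E e h)\<close>
    by (intro H_index_image_mono Min_image_mono \<open>finite e\<close> \<open>e \<noteq> {}\<close> le)
      (simp_all del: H_sup.simps)
  then show ?case
    by (subst (1 2) H_sup.simps(2))
qed

theorem theorem1:
  fixes V :: "'a set" and E :: "'a set set" and h n :: nat and e :: "'a set"
  assumes "finite_simple_graph V E"
    and "h > 0"
    and "n > 0"
    and "e \<in> E"
  shows "H_sup V E h n e \<ge> H_sup V E h (n + 1) e"
  using H_sup_Suc_le[OF assms(1,4)] by simp

end
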